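(* Let $H\subset\mathbb{R}$ be bounded, $a=\inf H$, $b=\sup H$, and let $I=H$ (with the usual metric). For $n\in\mathbb{N}$ let $\mathcal{S}_n$ be the set of all finite $K\subset I$ such that for every $i\in\{0,\dots,n-1\}$, with $\delta=\frac{b-a}n$, the set $K\cap[a+i\delta,a+(i+1)\delta)$ has exactly one element if $H\cap[a+i\delta,a+(i+1)\delta)\neq\emptyset$ and is empty otherwise. Let $\mathcal{S}=\bigcup_{n=1}^\infty\mathcal{S}_n$ and $\tilde s:\mathcal{S}\to\mathbb{R}$, $\tilde s(K)=\mathcal{A}(K)$. If $\mathcal{M}^{eds}(H)=A$, then $\mathrm{ext}(\tilde s,I)=A$, i.e. for every $\epsilon>0$ there is $\delta>0$ such that $K\in\mathcal{S}$ and $d_H(K,I)<\delta$ imply $|\tilde s(K)-A|<\epsilon$.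
   Context: $\mathcal{A}(K)$ denotes the arithmetic mean of the elements of a finite set $K\subset\mathbb{R}$. Definition of $\mathcal{M}^{eds}$: let $H\subset\mathbb{R}$ be bounded, $a=\inf H$, $b=\sup H$. For $n\in\mathbb{N}$ and $0\le i\le n$ let $H_{n,i}=H\cap[a+\frac in(b-a),a+\frac{i+1}n(b-a))$ and $I_n=\{0\le i\le n: H_{n,i}\ne\emptyset\}$. Then $\mathcal{M}^{eds}(H)=k$ means: for every $\epsilon>0$ there is $N\in\mathbb{N}$ such that $n>N$ and $\xi_i\in H_{n,i}$ ($i\in I_n$) imply $|\mathcal{A}(\{\xi_i:i\in I_n\})-k|<\epsilon$. For a metric space $(I,d)$, $B\subset I$ and $\epsilon>0$, let $S(B,\epsilon)=\bigcup_{x\in B}\{y\in I: d(x,y)<\epsilon\}$. The Hausdorff pseudo-metric on subsets of $I$ is $d_H(B,C)=\inf\{\epsilon>0: B\subset S(C,\epsilon),\ C\subset S(B,\epsilon)\}$ (with $\inf\emptyset=+\infty$). *)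

theory Defs
  imports "HOL-Analysis.Analysis"
begin

(* As a total function this returns 0 on the empty set, where the mean is really undefined;
   has_eds_mean below therefore asks explicitly that the means it uses exist. *)
definition arith_mean :: "real set \<Rightarrow> real" where
  "arith_mean K = (\<Sum>x\<in>K. x) / real (card K)"

definition grid_cell :: "real set \<Rightarrow> nat \<Rightarrow> nat \<Rightarrow> real set" where
  "grid_cell H n i =
     {Inf H + real i / real n * (Sup H - Inf H) ..< Inf H + real (i + 1) / real n * (Sup H - Inf H)}"

definition eds_part :: "real set \<Rightarrow> nat \<Rightarrow> nat \<Rightarrow> real set" where
  "eds_part H n i = H \<inter> grid_cell H n i"

(* The index n is included: its cell starts at Sup H and catches the supremum if it lies in H. *)
definition eds_index :: "real set \<Rightarrow> nat \<Rightarrow> nat set" where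
  "eds_index H n = {i. i \<le> n \<and> eds_part H n i \<noteq> {}}"

(* The equation "M^eds(H) = k" for a partially defined mean. The conjunct eds_index H n \<noteq> {}
   says that the arithmetic mean is taken of a nonempty set. It only fails when H is empty or a
   singleton (then all cells are empty), in which case M^eds(H) is undefined. *)
definition has_eds_mean :: "real set \<Rightarrow> real \<Rightarrow> bool" where
  "has_eds_mean H k \<longleftrightarrow>
     (\<forall>\<epsilon>>0. \<exists>N. \<forall>n>N. \<forall>\<xi>. (\<forall>i\<in>eds_index H n. \<xi> i \<in> eds_part H n i) \<longrightarrow>
        eds_index H n \<noteq> {} \<and> \<bar>arith_mean (\<xi> ` eds_index H n) - k\<bar> < \<epsilon>)"

(* The metric space is the subset I of the ambient type with the restricted distance. *)
definition nbhd_in :: "'a::metric_space set \<Rightarrow> 'a set \<Rightarrow> real \<Rightarrow> 'a set" where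
  "nbhd_in I B \<epsilon> = (\<Union>x\<in>B. {y \<in> I. dist x y < \<epsilon>})"

definition hausdorff_pdist :: "'a::metric_space set \<Rightarrow> 'a set \<Rightarrow> 'a set \<Rightarrow> ereal" where
  "hausdorff_pdist I B C =
     Inf {ereal \<epsilon> | \<epsilon>. \<epsilon> > 0 \<and> B \<subseteq> nbhd_in I C \<epsilon> \<and> C \<subseteq> nbhd_in I B \<epsilon>}"

(* There is no condition at Sup H: a member may or may not contain it when Sup H \<in> H. *)
definition selection_sets :: "real set \<Rightarrow> nat \<Rightarrow> real set set" where
  "selection_sets H n = {K. finite K \<and> K \<subseteq> H \<and>
     (\<forall>i<n. if H \<inter> grid_cell H n i \<noteq> {} then card (K \<inter> grid_cell H n i) = 1
            else K \<inter> grid_cell H n i = {})}"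

definition all_selection_sets :: "real set \<Rightarrow> real set set" where
  "all_selection_sets H = (\<Union>n\<in>{1..}. selection_sets H n)"

(* The equation "ext(s, I) = A" for a set function s with domain S, a family of subsets of I. *)
definition has_ext ::
    "'a::metric_space set set \<Rightarrow> ('a set \<Rightarrow> real) \<Rightarrow> 'a set \<Rightarrow> real \<Rightarrow> bool" where
  "has_ext S s I A \<longleftrightarrow>
     (\<forall>\<epsilon>>0. \<exists>\<delta>>0. \<forall>K\<in>S. hausdorff_pdist I K I < ereal \<delta> \<longrightarrow> \<bar>s K - A\<bar> < \<epsilon>)"

end

theory Submission
  imports Defs
begin

text \<open>
  Adding \<open>Sup H\<close> to a selection set \<open>K\<close> of order \<open>n\<close>, if it lies in \<open>H\<close>, turns \<open>K\<close> into a full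
  system of representatives of the nonempty cells, so the mean of the enlarged set is
  controlled once \<open>n\<close> is large. If \<open>H\<close> is infinite, then closeness of \<open>K\<close> to \<open>H\<close> forces \<open>K\<close> to
  have many points; hence \<open>n\<close> is large and the added point changes the mean only little. If \<open>H\<close> is
  finite, then closeness forces \<open>K = H\<close>, and \<open>H\<close> is a selection set of every large order.
\<close>

section \<open>Sets that are Hausdorff-close to a finite or an infinite set\<close>

lemma hausdorff_pdist_less_covers:
  assumes "hausdorff_pdist I B C < ereal \<delta>" and "y \<in> C"
  obtains x where "x \<in> B" "dist x y < \<delta>"
proof -
  obtain \<epsilon> where "\<epsilon> < \<delta>" "C \<subseteq> nbhd_in I B \<epsilon>"
    using assms(1) unfolding hausdorff_pdist_def Inf_less_iff by auto
  then show thesis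
    using assms(2) that unfolding nbhd_in_def by fastforce
qed

lemma finite_separated:
  fixes F :: "'a::metric_space set"
  assumes "finite F"
  obtains \<delta> where "\<delta> > 0" "\<And>x y. x \<in> F \<Longrightarrow> y \<in> F \<Longrightarrow> dist x y < \<delta> \<Longrightarrow> x = y"
proof -
  define P where "P = (\<lambda>(x, y). dist x y) ` {(x, y) \<in> F \<times> F. x \<noteq> y}"
  \<comment> \<open>The element 1 keeps the minimum meaningful when \<open>F\<close> has at most one
    point and \<open>P\<close> is empty.\<close>
  have fin: "finite (insert 1 P)"
    unfolding P_def using assms
    by (auto intro: finite_subset[of _ "F \<times> F"])
  have "Min (insert 1 P) > 0"
    using fin by (subst Min_gr_iff) (auto simp: P_def)
  moreover have "x = y" if "x \<in> F" "y \<in> F" "dist x y < Min (insert 1 P)" for x y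
  proof (rule ccontr)
    assume "x \<noteq> y"
    then have "dist x y \<in> insert 1 P"
      using that by (force simp: P_def)
    then show False
      using Min_le[OF fin] that(3) by fastforce
  qed
  ultimately show thesis
    using that by blast
qed

text \<open>Pick \<open>m\<close> points of \<open>H\<close>, separated by some
  \<open>\<delta>\<close>. The balls of radius \<open>\<delta> / 2\<close> around them are disjoint,
  and each has to contain a point of \<open>K\<close>.\<close>

lemma infinite_close_imp_card_ge:
  fixes H :: "'a::metric_space set"
  assumes "infinite H"
  obtains \<delta> where "\<delta> > 0"
    "\<And>K. finite K \<Longrightarrow> hausdorff_pdist I K H < ereal \<delta> \<Longrightarrow> m \<le> card K"
proof -
  obtain F where F: "F \<subseteq> H" "finite F" "card F = m"
    using infinite_arbitrarily_large[OF assms] by blast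
  obtain \<delta> where \<delta>: "\<delta> > 0" "\<And>x y. x \<in> F \<Longrightarrow> y \<in> F \<Longrightarrow> dist x y < \<delta> \<Longrightarrow> x = y"
    using finite_separated[OF F(2)] by blast
  have "m \<le> card K" if K: "finite K" "hausdorff_pdist I K H < ereal (\<delta> / 2)" for K
  proof -
    have "\<forall>y\<in>F. \<exists>x\<in>K. dist x y < \<delta> / 2"
      using hausdorff_pdist_less_covers[OF K(2)] F(1) by blast
    then obtain f where f: "\<And>y. y \<in> F \<Longrightarrow> f y \<in> K \<and> dist (f y) y < \<delta> / 2"
      by metis
    have "inj_on f F"
      proof (rule inj_onI)
      fix x y assume "x \<in> F" "y \<in> F" "f x = f y"
      then show "x = y"
        using f[of x] f[of y] dist_triangle_half_r[of "f x" x \<delta> y] \<delta>(2)[of x y] by simp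
    qed
    then show ?thesis
      using card_inj_on_le[of f F K] f K(1) F(3) by blast
  qed
  then show thesis
    using that[of "\<delta> / 2"] \<delta>(1) by simp
qed

text \<open>Below the separation of \<open>H\<close>, the only point of \<open>H\<close> near a
  given \<open>y\<close> is \<open>y\<close> itself, so \<open>K\<close> cannot miss it.\<close>

lemma finite_close_imp_eq:
  fixes H :: "'a::metric_space set"
  assumes "finite H"
  obtains \<delta> where "\<delta> > 0"
    "\<And>K. K \<subseteq> H \<Longrightarrow> hausdorff_pdist I K H < ereal \<delta> \<Longrightarrow> K = H"
proof -
  obtain \<delta> where \<delta>: "\<delta> > 0" "\<And>x y. x \<in> H \<Longrightarrow> y \<in> H \<Longrightarrow> dist x y < \<delta> \<Longrightarrow> x = y"
    using finite_separated[OF assms] by blast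
  have "K = H" if K: "K \<subseteq> H" "hausdorff_pdist I K H < ereal \<delta>" for K
  proof (intro equalityI subsetI)
    fix y assume "y \<in> H"
    then obtain x where "x \<in> K" "dist x y < \<delta>"
      using hausdorff_pdist_less_covers[OF K(2)] by blast
    then show "y \<in> K"
      using \<delta>(2)[of x y] \<open>y \<in> H\<close> K(1) by auto
  qed (use K(1) in auto)
  then show thesis
    by (rule that[OF \<delta>(1)])
qed

section \<open>Arithmetic means under the insertion of a point\<close>

lemma arith_mean_bounds:
  assumes "finite K" "K \<noteq> {}" "K \<subseteq> {a..b}"
  shows "arith_mean K \<in> {a..b}"
proof -
  have "card K > 0"
    using assms by (simp add: card_gt_0_iff)
  moreover have "of_nat (card K) * a \<le> (\<Sum>x\<in>K. x)"
    by (rule sum_bounded_below) (use assms(3) in auto)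
  moreover have "(\<Sum>x\<in>K. x) \<le> of_nat (card K) * b"
    by (rule sum_bounded_above) (use assms(3) in auto)
  ultimately show ?thesis
    by (simp add: arith_mean_def pos_le_divide_eq pos_divide_le_eq mult.commute)
qed

text \<open>A new point \<open>x\<close> moves the mean of \<open>k\<close> points by exactly the
  distance from \<open>x\<close> to that mean, divided by \<open>k + 1\<close>; both lie in
  \<open>{a..b}\<close>.\<close>

lemma arith_mean_insert_diff:
  assumes "finite K" "K \<noteq> {}" "K \<subseteq> {a..b}" "x \<in> {a..b}"
  shows "\<bar>arith_mean (insert x K) - arith_mean K\<bar> \<le> (b - a) / real (card K)"
proof (cases "x \<in> K")
  case True
  then show ?thesis
    using assms(4) by (simp add: insert_absorb)
next
  case False
  define k where "k = real (card K)"
  have k: "k > 0"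
    using assms(1,2) by (simp add: k_def card_gt_0_iff)
  have m: "arith_mean K \<in> {a..b}"
    using arith_mean_bounds[OF assms(1-3)] .
  have "arith_mean (insert x K) = (x + k * arith_mean K) / (k + 1)"
    using False assms(1) k by (simp add: arith_mean_def k_def add.commute)
  then have "arith_mean (insert x K) - arith_mean K = (x - arith_mean K) / (k + 1)"
    using k by (simp add: field_simps)
  moreover have "\<bar>x - arith_mean K\<bar> \<le> b - a"
    using m assms(4) by auto
  ultimately have "\<bar>arith_mean (insert x K) - arith_mean K\<bar> \<le> (b - a) / (k + 1)"
    using k by (simp add: divide_right_mono)
  also have "\<dots> \<le> (b - a) / k"
    using k assms(4) by (intro divide_left_mono) auto
  finally show ?thesis
    by (simp add: k_def)
qed

section \<open>Grid cells and systems of representatives\<close>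

lemma bounded_mem_Inf_Sup:
  fixes H :: "real set"
  assumes "bounded H" "x \<in> H"
  shows "Inf H \<le> x" "x \<le> Sup H"
  using assms bounded_imp_bdd_above bounded_imp_bdd_below by (auto intro: cInf_lower cSup_upper)

lemma eds_part_cover:
  assumes "bounded H" "Inf H < Sup H" "n > 0" "x \<in> H"
  obtains i where "i \<le> n" "x \<in> eds_part H n i"
proof -
  \<comment> \<open>\<open>t\<close> is the position of \<open>x\<close> counted in cell widths from
    \<open>Inf H\<close>, and its floor is the index of the cell. The index \<open>n\<close> arises
    only for \<open>x = Sup H\<close>.\<close>
  define t where "t = (x - Inf H) * real n / (Sup H - Inf H)"
  have bnds: "Inf H \<le> x" "x \<le> Sup H"
    using bounded_mem_Inf_Sup[OF assms(1,4)] .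
  have x: "x = Inf H + t / real n * (Sup H - Inf H)"
    using assms(2,3) by (simp add: t_def)
  have t: "0 \<le> t" "t \<le> real n"
    using bnds assms(2,3) by (auto simp: t_def divide_simps mult.commute mult_left_mono)
  define i where "i = nat \<lfloor>t\<rfloor>"
  have i: "real i \<le> t" "t < real (i + 1)"
    using t(1) unfolding i_def by linarith+
  then have "i \<le> n"
    using t(2) by linarith
  moreover have "real i / real n * (Sup H - Inf H) \<le> t / real n * (Sup H - Inf H)"
    using i(1) assms(2) by (intro mult_right_mono divide_right_mono) auto
  moreover have "t / real n * (Sup H - Inf H) < real (i + 1) / real n * (Sup H - Inf H)"
    using i(2) assms(2,3) by (intro mult_strict_right_mono divide_strict_right_mono) auto
  ultimately have "i \<le> n" "x \<in> eds_part H n i"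
    using x assms(4) unfolding eds_part_def grid_cell_def Int_iff atLeastLessThan_iff
    by linarith+
  then show thesis
    by (rule that)
qed

lemma grid_cell_less_Sup:
  assumes "Inf H \<le> Sup H" "i < n" "x \<in> grid_cell H n i"
  shows "x < Sup H"
proof -
  have "real (i + 1) / real n * (Sup H - Inf H) \<le> 1 * (Sup H - Inf H)"
    using assms(1,2) by (intro mult_right_mono) auto
  then show ?thesis
    using assms(3) by (simp add: grid_cell_def)
qed

lemma eds_part_last:
  assumes "bounded H" "Inf H < Sup H" "n > 0"
  shows "eds_part H n n = H \<inter> {Sup H}"
  using assms bounded_mem_Inf_Sup[OF assms(1)]
  by (fastforce simp: eds_part_def grid_cell_def add_divide_distrib distrib_right)

text \<open>This bridges the two notions of selection: \<open>selection_sets\<close> constrains the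
  cells below \<open>n\<close>, while \<open>has_eds_mean\<close> also selects from cell
  \<open>n\<close>. That cell meets \<open>H\<close> at most in \<open>Sup H\<close>, so adding this
  point supplies the missing representative.\<close>

lemma selection_set_choice:
  assumes "bounded H" "Inf H < Sup H" "n > 0" "K \<in> selection_sets H n"
  obtains \<xi> where "\<And>i. i \<in> eds_index H n \<Longrightarrow> \<xi> i \<in> eds_part H n i"
    "K \<union> (H \<inter> {Sup H}) = \<xi> ` eds_index H n"
proof -
  define K' where "K' = K \<union> (H \<inter> {Sup H})"
  have K: "K \<subseteq> H" "finite K"
    and sel: "\<And>i. i < n \<Longrightarrow> H \<inter> grid_cell H n i \<noteq> {} \<Longrightarrow> card (K \<inter> grid_cell H n i) = 1"
    using assms(4) unfolding selection_sets_def by (auto split: if_splits)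
  have sub: "K' \<subseteq> H"
    using K by (auto simp: K'_def)
  have "\<exists>x. K' \<inter> grid_cell H n i = {x}" if "i \<in> eds_index H n" for i
  proof (cases "i < n")
    case True
    \<comment> \<open>The added point lies outside every cell below \<open>n\<close>, so it cannot
      become a second representative there.\<close>
    have "Sup H \<notin> grid_cell H n i"
      using grid_cell_less_Sup[of H i n] True assms(2) by fastforce
    then have "K' \<inter> grid_cell H n i = K \<inter> grid_cell H n i"
      by (auto simp: K'_def)
    then show ?thesis
      using sel[OF True] that unfolding eds_index_def eds_part_def
      by (simp add: card_1_singleton_iff)
  next
    case False
    then have "i = n" "eds_part H n n \<noteq> {}"
      using that by (auto simp: eds_index_def)
    then have "H \<inter> grid_cell H n i = {Sup H}" "Sup H \<in> K'"
      using eds_part_last[OF assms(1-3)] by (auto simp: eds_part_def K'_def)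
    then show ?thesis
      using sub by blast
  qed
  then obtain \<xi> where \<xi>: "\<And>i. i \<in> eds_index H n \<Longrightarrow> K' \<inter> grid_cell H n i = {\<xi> i}"
    by metis
  have "\<xi> i \<in> eds_part H n i" if "i \<in> eds_index H n" for i
    using \<xi>[OF that] sub unfolding eds_part_def by blast
  moreover have "K' = \<xi> ` eds_index H n"
  proof (intro equalityI subsetI)
    fix x assume x: "x \<in> K'"
    then obtain i where i: "i \<le> n" "x \<in> eds_part H n i"
      using eds_part_cover[OF assms(1-3)] sub by blast
    then have "i \<in> eds_index H n"
      unfolding eds_index_def by blast
    moreover from this have "x = \<xi> i"
      using \<xi> i(2) x unfolding eds_part_def by blast
    ultimately show "x \<in> \<xi> ` eds_index H n"
      by blast
  qed (use \<xi> in blast)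
  ultimately show thesis
    by (rule that[folded K'_def])
qed

section \<open>Means, sizes and existence of selection sets of large order\<close>

lemma has_eds_mean_Inf_less_Sup:
  assumes "bounded H" "has_eds_mean H A"
  shows "Inf H < Sup H"
proof (rule ccontr)
  assume "\<not> Inf H < Sup H"
  \<comment> \<open>If \<open>Inf H = Sup H\<close>, all cells are half-open intervals of width
    zero, hence empty. The empty \<open>H\<close> is separate, as there
    \<open>Inf H \<le> Sup H\<close> cannot be derived from a member.\<close>
  have "eds_part H n i = {}" for n i
  proof (cases "H = {}")
    case False
    then have "Inf H \<le> Sup H"
      using bounded_mem_Inf_Sup[OF assms(1)] by fastforce
    then have "Inf H = Sup H"
      using \<open>\<not> Inf H < Sup H\<close> by simp
    then show ?thesis
      by (simp add: eds_part_def grid_cell_def)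
  qed (simp add: eds_part_def)
  then have "eds_index H n = {}" for n
    by (simp add: eds_index_def)
  moreover obtain N where
    "\<And>n \<xi>. n > N \<Longrightarrow> (\<forall>i\<in>eds_index H n. \<xi> i \<in> eds_part H n i) \<Longrightarrow> eds_index H n \<noteq> {}"
    using assms(2) unfolding has_eds_mean_def by (metis zero_less_one)
  \<comment> \<open>With an empty index set every \<open>\<xi>\<close> is an admissible choice, so
    any \<open>n > N\<close> contradicts the required nonemptiness.\<close>
  ultimately show False
    by (metis empty_iff lessI)
qed

text \<open>In \<open>has_eds_mean\<close> the threshold is fixed before the representatives are
  chosen, so one \<open>N\<close> serves all selection sets of larger order.\<close>

lemma has_eds_mean_selection_sets:
  assumes "bounded H" "has_eds_mean H A" "\<epsilon> > 0"
  obtains N where "\<And>n K. n > N \<Longrightarrow> K \<in> selection_sets H n \<Longrightarrow>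
    \<bar>arith_mean (K \<union> (H \<inter> {Sup H})) - A\<bar> < \<epsilon>"
proof -
  obtain N where N: "\<And>n \<xi>. n > N \<Longrightarrow> (\<forall>i\<in>eds_index H n. \<xi> i \<in> eds_part H n i) \<Longrightarrow>
      \<bar>arith_mean (\<xi> ` eds_index H n) - A\<bar> < \<epsilon>"
    using assms(2,3) unfolding has_eds_mean_def by metis
  have "\<bar>arith_mean (K \<union> (H \<inter> {Sup H})) - A\<bar> < \<epsilon>" if n: "n > N" and K: "K \<in> selection_sets H n"
    for n K
  proof -
    have "n > 0"
      using n by simp
    from selection_set_choice[OF assms(1) has_eds_mean_Inf_less_Sup[OF assms(1,2)] this K]
    obtain \<xi> where \<xi>: "\<And>i. i \<in> eds_index H n \<Longrightarrow> \<xi> i \<in> eds_part H n i"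
      "K \<union> (H \<inter> {Sup H}) = \<xi> ` eds_index H n"
      by metis
    then show ?thesis
      using N[OF n, of \<xi>] by simp
  qed
  then show thesis
    by (rule that)
qed

text \<open>There is at most one point for each of the indices from 0 to \<open>n\<close>. Read
  backwards, a large \<open>K\<close> must have large order.\<close>

lemma card_selection_set_le:
  assumes "bounded H" "Inf H < Sup H" "n > 0" "K \<in> selection_sets H n"
  shows "card K \<le> n + 1"
proof -
  obtain \<xi> where \<xi>: "K \<union> (H \<inter> {Sup H}) = \<xi> ` eds_index H n"
    by (rule selection_set_choice[OF assms])
  have "eds_index H n \<subseteq> {..n}"
    by (auto simp: eds_index_def)
  then have "K \<subseteq> \<xi> ` {..n}"
    using \<xi> by blast
  then show ?thesis
    using surj_card_le[of "{..n}" K \<xi>] by simp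
qed

text \<open>Once the cell width falls below the separation of \<open>H\<close>, no cell holds two
  points of \<open>H\<close>.\<close>

lemma finite_self_selection_set:
  assumes "finite H"
  obtains n where "n > N" "H \<in> selection_sets H n"
proof -
  obtain \<delta> where \<delta>: "\<delta> > 0" "\<And>x y. x \<in> H \<Longrightarrow> y \<in> H \<Longrightarrow> dist x y < \<delta> \<Longrightarrow> x = y"
    using finite_separated[OF assms] by blast
  obtain n0 :: nat where n0: "(Sup H - Inf H) / \<delta> < real n0"
    using reals_Archimedean2 by blast
  define n where "n = max n0 (N + 1)"
  have n: "n > N" "n > 0" "(Sup H - Inf H) / \<delta> < real n"
    using n0 by (auto simp: n_def)
  then have small: "(Sup H - Inf H) / real n < \<delta>"
    using \<delta>(1) by (simp add: field_simps)
  have uniq: "x = y" if "x \<in> H \<inter> grid_cell H n i" "y \<in> H \<inter> grid_cell H n i" for x y i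
  proof (rule \<delta>(2))
    have "real (i + 1) / real n * (Sup H - Inf H)
        = real i / real n * (Sup H - Inf H) + (Sup H - Inf H) / real n"
      by (simp add: add_divide_distrib distrib_right)
    then show "dist x y < \<delta>"
      using that small by (auto simp: grid_cell_def dist_real_def)
  qed (use that in auto)
  have "card (H \<inter> grid_cell H n i) = 1" if "H \<inter> grid_cell H n i \<noteq> {}" for i
    using that uniq[of _ i] is_singletonI' unfolding is_singleton_altdef[symmetric] by metis
  then have "H \<in> selection_sets H n"
    using assms by (simp add: selection_sets_def)
  with n(1) show thesis
    by (rule that)
qed

theorem theorem4p26:
  fixes H :: "real set" and A :: real
  assumes "bounded H"
    and "has_eds_mean H A"
  shows "has_ext (all_selection_sets H) arith_mean H A"
  unfolding has_ext_def
proof (intro allI impI)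
  fix \<epsilon> :: real assume \<epsilon>: "\<epsilon> > 0"
  have less: "Inf H < Sup H"
    using has_eds_mean_Inf_less_Sup[OF assms] .
  obtain N where N: "\<And>n K. n > N \<Longrightarrow> K \<in> selection_sets H n \<Longrightarrow>
      \<bar>arith_mean (K \<union> (H \<inter> {Sup H})) - A\<bar> < \<epsilon> / 2"
    using has_eds_mean_selection_sets[OF assms, of "\<epsilon> / 2"] \<epsilon> by auto
  show "\<exists>\<delta>>0. \<forall>K\<in>all_selection_sets H.
      hausdorff_pdist H K H < ereal \<delta> \<longrightarrow> \<bar>arith_mean K - A\<bar> < \<epsilon>"
  proof (cases "finite H")
    case True
    \<comment> \<open>A set close to \<open>H\<close> equals \<open>H\<close> here, whatever order
      it was selected with; the estimate is therefore taken at some large order for which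
      \<open>H\<close> is a selection set.\<close>
    obtain n where "n > N" "H \<in> selection_sets H n"
      using finite_self_selection_set[OF True] by blast
    then have "\<bar>arith_mean (H \<union> (H \<inter> {Sup H})) - A\<bar> < \<epsilon> / 2"
      by (rule N)
    then have "\<bar>arith_mean H - A\<bar> < \<epsilon>"
      using \<epsilon> by (simp add: Un_absorb2)
    moreover obtain \<delta> where "\<delta> > 0"
      "\<And>K. K \<subseteq> H \<Longrightarrow> hausdorff_pdist H K H < ereal \<delta> \<Longrightarrow> K = H"
      using finite_close_imp_eq[OF True] by blast
    moreover have "K \<subseteq> H" if "K \<in> all_selection_sets H" for K
      using that by (auto simp: all_selection_sets_def selection_sets_def)
    ultimately show ?thesis
      by metis
  next
    case False
    \<comment> \<open>With at least \<open>M\<close> points, inserting \<open>Sup H\<close> costs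
      less than \<open>\<epsilon> / 2\<close>.\<close>
    obtain M :: nat where M: "(Sup H - Inf H) / (\<epsilon> / 2) < real M"
      using reals_Archimedean2 by blast
    \<comment> \<open>The bound \<open>N + 2\<close> matches \<open>card K \<le> n + 1\<close>:
      together they give \<open>n > N\<close>. It also makes \<open>K\<close> nonempty.\<close>
    obtain \<delta> where \<delta>: "\<delta> > 0"
      "\<And>K. finite K \<Longrightarrow> hausdorff_pdist H K H < ereal \<delta> \<Longrightarrow> max M (N + 2) \<le> card K"
      using infinite_close_imp_card_ge[OF False] by blast
    have "\<bar>arith_mean K - A\<bar> < \<epsilon>"
      if "K \<in> all_selection_sets H" and close: "hausdorff_pdist H K H < ereal \<delta>" for K
    proof -
      from that(1) obtain n where "n \<in> {1..}" and K: "K \<in> selection_sets H n"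
        unfolding all_selection_sets_def by (rule UN_E)
      then have n: "n > 0"
        by simp
      have sub: "finite K" "K \<subseteq> H"
        using K by (auto simp: selection_sets_def)
      have card: "M \<le> card K" "N + 2 \<le> card K"
        using \<delta>(2)[OF sub(1) close] by auto
      then have "n > N"
        using card_selection_set_le[OF assms(1) less n K] by linarith
      then have near: "\<bar>arith_mean (K \<union> (H \<inter> {Sup H})) - A\<bar> < \<epsilon> / 2"
        using N K by blast
      have "(Sup H - Inf H) / (\<epsilon> / 2) < real (card K)"
        using M card(1) by linarith
      then have small: "(Sup H - Inf H) / real (card K) < \<epsilon> / 2"
        using \<epsilon> card(2) by (simp add: field_simps)
      have "\<bar>arith_mean (K \<union> (H \<inter> {Sup H})) - arith_mean K\<bar> < \<epsilon> / 2"
      proof (cases "Sup H \<in> H")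
        case True
        have "K \<subseteq> {Inf H..Sup H}"
          using sub(2) bounded_mem_Inf_Sup[OF assms(1)] by auto
        moreover have "K \<noteq> {}"
          using card(2) by auto
        ultimately have "\<bar>arith_mean (insert (Sup H) K) - arith_mean K\<bar>
            \<le> (Sup H - Inf H) / real (card K)"
          using arith_mean_insert_diff[OF sub(1)] less by simp
        also note small
        finally show ?thesis
          using True by simp
      qed (use \<epsilon> in simp)
      then show ?thesis
        using near by linarith
    qed
    then show ?thesis
      using \<delta>(1) by blast
  qed
qed

end
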